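(* Let $\mathfrak P$ be the class of the finite groups whose order is divisible by at most one prime. Then for any finite group $G$ the graph $\Gamma_{\mathfrak P}(G)$ is connected.
   Context: For a class $\mathfrak F$ of finite groups and a finite group $G$, $\widetilde\Gamma_{\mathfrak F}(G)$ is the graph whose vertices are the elements of $G$ and where $g,h\in G$ are adjacent if and only if $\langle g,h\rangle\notin\mathfrak F$. The graph $\Gamma_{\mathfrak F}(G)$ is obtained from $\widetilde\Gamma_{\mathfrak F}(G)$ by deleting the isolated vertices (those $g\in G$ with $\langle g,h\rangle\in\mathfrak F$ for all $h\in G$); the empty graph is regarded as connected. *)

theory Defs
  imports
    "HOL-Algebra.Generated_Groups"
    "HOL-Computational_Algebra.Primes"
    "Graph_Theory.Digraph_Component"
begin

text \<open>
  A class of finite groups is represented by the set of its members with carrier in the ambient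
  type; only subgroups of the given group are ever tested for membership.
\<close>

definition two_generated :: "('a, 'b) monoid_scheme \<Rightarrow> 'a \<Rightarrow> 'a \<Rightarrow> ('a, 'b) monoid_scheme" where
  "two_generated G g h = G\<lparr>carrier := generate G {g, h}\<rparr>"

text \<open>
  Undirected graphs are symmetric digraphs, as usual in \<^theory>\<open>Graph_Theory.Digraph\<close>.
  Adjacency is not restricted to distinct elements, so an element generating a cyclic group outside
  the class carries a loop. Thus the isolated vertices are exactly those without any incident arc.
\<close>

definition full_non_F_graph ::
    "('a, 'b) monoid_scheme set \<Rightarrow> ('a, 'b) monoid_scheme \<Rightarrow> 'a pair_pre_digraph" where
  "full_non_F_graph \<FF> G =
     \<lparr>pverts = carrier G,
      parcs = {(g, h). g \<in> carrier G \<and> h \<in> carrier G \<and> two_generated G g h \<notin> \<FF>}\<rparr>"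

definition isolated_elements ::
    "('a, 'b) monoid_scheme set \<Rightarrow> ('a, 'b) monoid_scheme \<Rightarrow> 'a set" where
  "isolated_elements \<FF> G = {g \<in> carrier G. \<forall>h \<in> carrier G. two_generated G g h \<in> \<FF>}"

definition non_F_graph ::
    "('a, 'b) monoid_scheme set \<Rightarrow> ('a, 'b) monoid_scheme \<Rightarrow> ('a, 'a \<times> 'a) pre_digraph" where
  "non_F_graph \<FF> G =
     induce_subgraph (with_proj (full_non_F_graph \<FF> G)) (carrier G - isolated_elements \<FF> G)"

text \<open>The library's notion of connectedness excludes the empty graph; here it is included.\<close>

definition connected_or_empty :: "('a, 'b) pre_digraph \<Rightarrow> bool" where
  "connected_or_empty D \<longleftrightarrow> verts D = {} \<or> Digraph_Component.connected D"

definition prime_power_order_groups :: "('a, 'b) monoid_scheme set" where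
  "prime_power_order_groups =
     {H. group H \<and> finite (carrier H) \<and> card {p :: nat. prime p \<and> p dvd order H} \<le> 1}"

lemma full_non_F_graph_sym: "sym (parcs (full_non_F_graph \<FF> G))"
  by (auto simp: full_non_F_graph_def two_generated_def sym_def insert_commute)

lemma isolated_elements_iff_no_arc:
  "isolated_elements \<FF> G =
     {g \<in> carrier G. \<forall>e \<in> parcs (full_non_F_graph \<FF> G). fst e \<noteq> g \<and> snd e \<noteq> g}"
  by (auto simp: isolated_elements_def full_non_F_graph_def two_generated_def insert_commute)

end

theory Submission
  imports Defs "HOL-Algebra.Sylow" "HOL-Algebra.Multiplicative_Group"
begin

text \<open>
  By Lagrange's theorem, if distinct primes \<open>p\<close> and \<open>q\<close> divide the orders of \<open>g\<close> and \<open>h\<close>, or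
  both divide the order of \<open>g\<close>, then both divide the order of \<open>\<langle>g, h\<rangle>\<close>, so \<open>g\<close> and
  \<open>h\<close> are adjacent (\<open>distinct_primes_imp_not_prime_power\<close>).

  If two primes divide the order of a single element, that element is adjacent to every element, and
  the graph is connected. Otherwise every element has prime power order. Then the identity is
  isolated, because \<open>\<langle>1, h\<rangle> = \<langle>h\<rangle>\<close>, so every vertex of the graph is a nontrivial
  \<open>p\<close>-element for some prime \<open>p\<close>. Vertices belonging to different primes are adjacent. If two
  vertices belong to the same prime \<open>p\<close>, then, since an edge exists at all, some other prime \<open>r\<close>
  divides the order of the group; an element of order \<open>r\<close>, given by Cauchy's theorem
  (\<open>element_of_prime_order_exists\<close>), is adjacent to both. So any two vertices are joined by a path of
  length at most two.
\<close>

text \<open>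
  The order of an element may be computed in any subgroup containing it, since it is the size of the
  cyclic subgroup it generates; Lagrange's theorem is then applied inside \<open>H\<close>.
\<close>

lemma (in group) ord_dvd_card_subgroup:
  assumes "subgroup H G" and "x \<in> H"
  shows "ord x dvd card H"
proof -
  interpret H: group "G\<lparr>carrier := H\<rparr>"
    by (rule subgroup_imp_group[OF assms(1)])
  have "x \<in> carrier G"
    using assms subgroup.subset by blast
  then have "ord x = card (generate G {x})"
    by (rule generate_pow_card)
  also have "\<dots> = H.ord x"
    using generate_consistent[OF _ assms(1), of "{x}"] H.generate_pow_card[of x] assms(2) by simp
  also have "\<dots> dvd order (G\<lparr>carrier := H\<rparr>)"
    using assms(2) by (intro H.ord_dvd_group_order) simp
  finally show ?thesis
    by (simp add: order_def)
qed

text \<open>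
  Cauchy's theorem: Sylow's theorem for the exponent one gives a subgroup of order \<open>p\<close>, each of whose
  nontrivial elements has order \<open>p\<close>.
\<close>

lemma (in group) element_of_prime_order_exists:
  fixes p :: nat
  assumes "finite (carrier G)" and "prime p" and "p dvd order G"
  obtains x where "x \<in> carrier G" and "ord x = p"
proof -
  obtain m where "order G = p ^ 1 * m"
    using assms(3) by auto
  then obtain H where H: "subgroup H G" "card H = p ^ 1"
    using sylow_thm[OF assms(2) is_group _ assms(1)] by blast
  have "\<not> H \<subseteq> {\<one>}"
    using H(2) prime_gt_1_nat[OF assms(2)] card_mono[of "{\<one>}" H] by auto
  then obtain x where x: "x \<in> H" "x \<noteq> \<one>"
    by blast
  have xG: "x \<in> carrier G"
    using x(1) H(1) subgroup.subset by blast
  have "ord x dvd p"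
    using ord_dvd_card_subgroup[OF H(1) x(1)] H(2) by simp
  then have "ord x = p"
    using x(2) ord_eq_1[OF xG] assms(2) by (auto simp: prime_nat_iff)
  with xG show ?thesis by (rule that)
qed

lemma card_le_1_iff_all_eq:
  assumes "finite A"
  shows "card A \<le> 1 \<longleftrightarrow> (\<forall>a\<in>A. \<forall>b\<in>A. a = b)"
  using card_le_Suc0_iff_eq[OF assms] by simp

text \<open>
  One direction recognises edges; the other extracts from a given edge two primes dividing the order
  of the group, and shows that no edge meets the identity when all elements have prime power order.
\<close>

lemma (in group) not_prime_power_two_generated_iff:
  assumes "finite (carrier G)" and "g \<in> carrier G" and "h \<in> carrier G"
  shows "two_generated G g h \<notin> prime_power_order_groups \<longleftrightarrow>
    (\<exists>p q. prime p \<and> prime q \<and> p \<noteq> q \<and>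
      p dvd card (generate G {g, h}) \<and> q dvd card (generate G {g, h}))"
proof -
  have sub: "subgroup (generate G {g, h}) G"
    using assms by (intro generate_is_subgroup) auto
  have fin: "finite (generate G {g, h})"
    using sub assms(1) finite_subset subgroup.subset by blast
  have "\<one> \<in> generate G {g, h}"
    by (rule generate.one)
  then have "card (generate G {g, h}) > 0"
    using fin card_gt_0_iff by blast
  then have "finite {p. prime p \<and> p dvd card (generate G {g, h})}"
    by simp
  from card_le_1_iff_all_eq[OF this] show ?thesis
    using fin subgroup_imp_group[OF sub]
    by (auto simp: prime_power_order_groups_def two_generated_def order_def)
qed

lemma (in group) distinct_primes_imp_not_prime_power:
  assumes "finite (carrier G)" and "g \<in> carrier G" and "h \<in> carrier G"
    and "prime p" and "prime q" and "p \<noteq> q"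
    and "p dvd ord g" and "q dvd ord g \<or> q dvd ord h"
  shows "two_generated G g h \<notin> prime_power_order_groups"
proof -
  have sub: "subgroup (generate G {g, h}) G"
    using assms(2,3) by (intro generate_is_subgroup) auto
  have "ord g dvd card (generate G {g, h})" "ord h dvd card (generate G {g, h})"
    by (auto intro!: ord_dvd_card_subgroup[OF sub] generate.incl)
  then have "p dvd card (generate G {g, h})" "q dvd card (generate G {g, h})"
    using assms(7,8) dvd_trans by blast+
  then show ?thesis
    using not_prime_power_two_generated_iff[OF assms(1-3)] assms(4-6) by blast
qed

text \<open>
  Edges of the graph without isolated vertices are the edges of the full graph, as an end of an edge
  is never isolated. So paths may be built without asking whether the vertices on them survive.
\<close>

lemma connected_or_empty_non_F_graphI:
  assumes path: "\<And>u v. u \<in> carrier G - isolated_elements \<FF> G \<Longrightarrow>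
      v \<in> carrier G - isolated_elements \<FF> G \<Longrightarrow>
      two_generated G u v \<notin> \<FF> \<or>
      (\<exists>w\<in>carrier G. two_generated G u w \<notin> \<FF> \<and> two_generated G w v \<notin> \<FF>)"
  shows "connected_or_empty (non_F_graph \<FF> G)"
proof -
  define S where "S = mk_symmetric (non_F_graph \<FF> G)"
  have verts: "pverts S = carrier G - isolated_elements \<FF> G"
    by (simp add: S_def non_F_graph_def)
  interpret S: pair_wf_digraph S
    by unfold_locales
      (auto simp: S_def parcs_mk_symmetric non_F_graph_def induce_subgraph_def)
  have arc: "(u, w) \<in> parcs S"
    if "u \<in> carrier G" "w \<in> carrier G" "two_generated G u w \<notin> \<FF>" for u w
  proof -
    have "two_generated G w u \<notin> \<FF>"
      using that(3) by (simp add: two_generated_def insert_commute)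
    with that show ?thesis
      by (fastforce simp: S_def parcs_mk_symmetric non_F_graph_def induce_subgraph_def
          full_non_F_graph_def isolated_elements_def)
  qed
  have "u \<rightarrow>\<^sup>*\<^bsub>S\<^esub> v" if "u \<in> pverts S" "v \<in> pverts S" for u v
  proof -
    have uv: "u \<in> carrier G" "v \<in> carrier G"
      using that by (auto simp: verts)
    from path[of u v] that consider
        "two_generated G u v \<notin> \<FF>"
      | w where "w \<in> carrier G" "two_generated G u w \<notin> \<FF>" "two_generated G w v \<notin> \<FF>"
      unfolding verts by blast
    then show ?thesis
    proof cases
      case 1
      then show ?thesis
        using arc uv by (intro S.reachable_adjI) simp
    next
      case 2
      then have "u \<rightarrow>\<^sup>*\<^bsub>S\<^esub> w" "w \<rightarrow>\<^sup>*\<^bsub>S\<^esub> v"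
        using arc uv by (auto intro!: S.reachable_adjI)
      then show ?thesis
        by (rule S.reachable_trans)
    qed
  qed
  then show ?thesis
    by (auto simp: connected_or_empty_def connected_def strongly_connected_def S_def)
qed

theorem proposition20:
  fixes G :: "('a, 'b) monoid_scheme"
  assumes "group G" and "finite (carrier G)"
  shows "connected_or_empty (non_F_graph prime_power_order_groups G)"
proof -
  interpret group G by (fact assms(1))
  note distinct_primes = distinct_primes_imp_not_prime_power[OF assms(2)]
  have sym: "two_generated G g h = two_generated G h g" for g h
    by (simp add: two_generated_def insert_commute)
  show ?thesis
  proof (rule connected_or_empty_non_F_graphI)
    fix u v
    assume u: "u \<in> carrier G - isolated_elements prime_power_order_groups G"
      and v: "v \<in> carrier G - isolated_elements prime_power_order_groups G"
    have uG: "u \<in> carrier G" and vG: "v \<in> carrier G"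
      using u v by auto
    show "two_generated G u v \<notin> prime_power_order_groups \<or>
      (\<exists>w\<in>carrier G. two_generated G u w \<notin> prime_power_order_groups \<and>
        two_generated G w v \<notin> prime_power_order_groups)"
    proof (cases "\<exists>x\<in>carrier G. \<exists>p q. prime p \<and> prime q \<and> p \<noteq> q \<and> p dvd ord x \<and> q dvd ord x")
      case True
      then obtain x p q where "x \<in> carrier G" "prime p" "prime q" "p \<noteq> q"
        "p dvd ord x" "q dvd ord x"
        by blast
      then have "two_generated G x g \<notin> prime_power_order_groups" if "g \<in> carrier G" for g
        using distinct_primes[of x g p q] that by blast
      then show ?thesis
        using \<open>x \<in> carrier G\<close> uG vG sym by metis
    next
      case False
      have nontrivial: "g \<noteq> \<one>\<^bsub>G\<^esub>"
        if "g \<in> carrier G - isolated_elements prime_power_order_groups G" for g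
      proof
        assume "g = \<one>\<^bsub>G\<^esub>"
        with that obtain h where h: "h \<in> carrier G"
          and nonpp: "two_generated G \<one>\<^bsub>G\<^esub> h \<notin> prime_power_order_groups"
          by (auto simp: isolated_elements_def)
        have "subgroup (generate G {h}) G"
          using h by (intro generate_is_subgroup) auto
        then have "generate G {\<one>\<^bsub>G\<^esub>, h} \<subseteq> generate G {h}"
          by (intro generate_subgroup_incl) (auto intro: generate.one generate.incl)
        then have "generate G {\<one>\<^bsub>G\<^esub>, h} = generate G {h}"
          using mono_generate[of "{h}" "{\<one>\<^bsub>G\<^esub>, h}"] by blast
        then have "card (generate G {\<one>\<^bsub>G\<^esub>, h}) = ord h"
          using generate_pow_card[OF h] by simp
        then show False
          using nonpp False h not_prime_power_two_generated_iff[OF assms(2) one_closed h]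
          by auto
      qed
      have prime_divisor: "\<exists>p. prime p \<and> p dvd ord g"
        if "g \<in> carrier G - isolated_elements prime_power_order_groups G" for g
        using nontrivial[OF that] ord_eq_1[of g] that prime_factor_nat[of "ord g"] by auto
      obtain p q where p: "prime p" "p dvd ord u" and q: "prime q" "q dvd ord v"
        using prime_divisor[OF u] prime_divisor[OF v] by blast
      show ?thesis
      proof (cases "p = q")
        case False
        then show ?thesis
          using distinct_primes[OF uG vG p(1) q(1)] p(2) q(2) by blast
      next
        case True
        \<comment> \<open>The order of \<open>u\<close> offers no second prime here; an edge at \<open>u\<close> does.\<close>
        obtain h where h: "h \<in> carrier G"
          and uh: "two_generated G u h \<notin> prime_power_order_groups"
          using u by (auto simp: isolated_elements_def)
        have "subgroup (generate G {u, h}) G"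
          using uG h by (intro generate_is_subgroup) auto
        then have "card (generate G {u, h}) dvd order G"
          using lagrange dvd_triv_right by metis
        moreover obtain r where "prime r" "r \<noteq> p" "r dvd card (generate G {u, h})"
          using uh not_prime_power_two_generated_iff[OF assms(2) uG h] by metis
        ultimately have r: "prime r" "r \<noteq> p" "r dvd order G"
          using dvd_trans by blast+
        obtain w where w: "w \<in> carrier G" "ord w = r"
          using element_of_prime_order_exists[OF assms(2) r(1,3)] by blast
        have "two_generated G u w \<notin> prime_power_order_groups"
          using distinct_primes[OF uG w(1) p(1) r(1)] p(2) r(2) w(2) by auto
        moreover have "two_generated G w v \<notin> prime_power_order_groups"
          using distinct_primes[OF w(1) vG r(1) q(1)] q(2) r(2) w(2) True by auto
        ultimately show ?thesis
          using w(1) by blast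
      qed
    qed
  qed
qed

end
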